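(* Let $d\in\mathbb N$, $a\in\mathbb N_0$, $n\in\mathbb N_0$. Then, as formal power series in $x$, $$\sum_{m=0}^{\infty}\Big(\sum_{j=0}^m (a+d\,j)^n\Big)x^m=\sum_{k=0}^n S2(d,a;n,k)\,k!\,\frac{x^k}{(1-x)^{k+2}}.$$
   Context: $\mathbb N=\{1,2,\dots\}$, $\mathbb N_0=\{0,1,2,\dots\}$, $0^0:=1$. The generalized Stirling numbers of the second kind $S2(d,a;n,m)$, $0\le m\le n$, are defined by the operator identity $(a\,\mathbf 1+d\,\mathbf E_x)^n=\sum_{m=0}^n S2(d,a;n,m)\,x^m\,\mathbf d_x^{\,m}$, where $\mathbf d_x$ is differentiation with respect to $x$, $\mathbf E_x:=x\,\mathbf d_x$ is the Euler operator and $\mathbf 1$ is the identity operator. *)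

theory Defs
  imports "HOL-Computational_Algebra.Formal_Power_Series"
begin

unbundle fps_syntax

definition euler_op :: "real fps \<Rightarrow> real fps" where
  "euler_op f = fps_X * fps_deriv f"

definition lin_euler_op :: "nat \<Rightarrow> nat \<Rightarrow> real fps \<Rightarrow> real fps" where
  "lin_euler_op d a f = of_nat a * f + of_nat d * euler_op f"

(* The coefficients of the normal-ordered form of the n-th iterate of a + d E_x;
   the family is extended by 0 to m > n. The operators act on formal power series. *)
definition is_S2_row :: "nat \<Rightarrow> nat \<Rightarrow> nat \<Rightarrow> (nat \<Rightarrow> real) \<Rightarrow> bool" where
  "is_S2_row d a n c \<longleftrightarrow>
     (\<forall>m>n. c m = 0) \<and>
     (\<forall>f. (lin_euler_op d a ^^ n) f
            = (\<Sum>m=0..n. fps_const (c m) * (fps_X ^ m * fps_nth_deriv m f)))"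

definition S2 :: "nat \<Rightarrow> nat \<Rightarrow> nat \<Rightarrow> nat \<Rightarrow> real" where
  "S2 d a n = (THE c. is_S2_row d a n c)"

lemma nth_lin_euler_op: "lin_euler_op d a f $ k = (real a + real d * real k) * f $ k"
proof -
  have "(fps_X * fps_deriv f) $ k = real k * f $ k"
    by (cases k) auto
  then show ?thesis
    by (simp add: lin_euler_op_def euler_op_def fps_of_nat[symmetric] algebra_simps
          del: fps_of_nat)
qed

lemma nth_lin_euler_op_funpow:
  "(lin_euler_op d a ^^ n) f $ k = (real a + real d * real k) ^ n * f $ k"
  by (induction n) (simp_all add: nth_lin_euler_op)

lemma nth_nth_deriv:
  "fps_nth_deriv m f $ k = fact m * real ((k + m) choose m) * f $ (k + m)"
  for f :: "real fps"
proof (induction m arbitrary: k)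
  case (Suc m)
  have eq: "Suc m * (Suc (k + m) choose Suc m) = Suc k * (Suc (k + m) choose m)"
    using binomial_absorb_comp[of "Suc (k + m)" m] Suc_times_binomial[of m "k + m"]
    by (simp add: Suc_diff_le)
  have "fps_nth_deriv (Suc m) f $ k = real (Suc k) * fps_nth_deriv m f $ Suc k"
    by (simp only: fps_nth_deriv_commute fps_deriv_nth) simp
  also have "\<dots> = fact m * real (Suc k * (Suc (k + m) choose m)) * f $ (Suc k + m)"
    unfolding Suc.IH by (simp only: of_nat_mult add_Suc add_Suc_right mult_ac)
  also have "\<dots> = fact (Suc m) * real ((k + Suc m) choose Suc m) * f $ (k + Suc m)"
    unfolding eq[symmetric] by (simp only: fact_Suc of_nat_mult add_Suc add_Suc_right mult_ac)
  finally show ?case .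
qed simp

lemma nth_X_power_nth_deriv:
  "(fps_X ^ m * fps_nth_deriv m f) $ k = fact m * real (k choose m) * f $ k"
  for f :: "real fps"
  by (simp add: fps_X_power_mult_nth nth_nth_deriv)

lemma is_S2_row_iff:
  "is_S2_row d a n c \<longleftrightarrow>
     (\<forall>m>n. c m = 0) \<and>
     (\<forall>k. (real a + real d * real k) ^ n = (\<Sum>m=0..n. c m * (fact m * real (k choose m))))"
proof -
  have "(\<forall>f. (lin_euler_op d a ^^ n) f
            = (\<Sum>m=0..n. fps_const (c m) * (fps_X ^ m * fps_nth_deriv m f)))
     \<longleftrightarrow> (\<forall>f k. (real a + real d * real k) ^ n * f $ k
            = (\<Sum>m=0..n. c m * (fact m * real (k choose m))) * (f :: real fps) $ k)"
    by (simp add: fps_eq_iff nth_lin_euler_op_funpow fps_sum_nth nth_X_power_nth_deriv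
          sum_distrib_right mult.assoc)
  also have "\<dots> \<longleftrightarrow> (\<forall>k. (real a + real d * real k) ^ n
            = (\<Sum>m=0..n. c m * (fact m * real (k choose m))))"
    by (auto dest: spec[of _ "Abs_fps (\<lambda>_. 1)"])
  finally show ?thesis
    by (simp add: is_S2_row_def)
qed

lemma is_S2_row_exists: "\<exists>c. is_S2_row d a n c"
proof (induction n)
  case 0
  show ?case
    by (rule exI[of _ "\<lambda>m. if m = 0 then 1 else 0"]) (simp add: is_S2_row_iff)
next
  case (Suc n)
  then obtain c where c0: "\<And>m. m > n \<Longrightarrow> c m = 0"
    and c: "\<And>k. (real a + real d * real k) ^ n
              = (\<Sum>m=0..n. c m * (fact m * real (k choose m)))"
    by (auto simp: is_S2_row_iff)
  define c' where "c' m = (real a + real d * real m) * c m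
      + real d * (if m = 0 then 0 else c (m - 1))" for m
  let ?b = "\<lambda>k m. fact m * real (k choose m) :: real"
  have step: "(real a + real d * real k) * ?b k m
      = (real a + real d * real m) * ?b k m + real d * ?b k (Suc m)" for k m
  proof -
    have "real (Suc m * (k choose Suc m)) = (real k - real m) * real (k choose m)"
    proof (cases "m \<le> k")
      case True
      have "Suc m * (k choose Suc m) = (k - m) * (k choose m)"
        using binomial_absorb_comp[of k m] binomial_absorption[of m k] by simp
      then show ?thesis
        using True by (metis of_nat_diff of_nat_mult)
    qed (simp add: binomial_eq_0)
    then have "fact m * real (Suc m * (k choose Suc m)) = (real k - real m) * ?b k m"
      by simp
    then have "?b k (Suc m) = (real k - real m) * ?b k m"
      by (simp only: fact_Suc of_nat_mult mult_ac)
    then show ?thesis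
      by (simp only:) (simp add: algebra_simps)
  qed
  have "(real a + real d * real k) ^ Suc n = (\<Sum>m=0..Suc n. c' m * ?b k m)" for k
  proof -
    have "(real a + real d * real k) ^ Suc n
        = (\<Sum>m=0..n. c m * ((real a + real d * real k) * ?b k m))"
      by (simp only: power_Suc c sum_distrib_left mult.left_commute)
    also have "\<dots> = (\<Sum>m=0..n. (real a + real d * real m) * c m * ?b k m)
        + (\<Sum>m=0..n. real d * c m * ?b k (Suc m))"
      unfolding step by (simp only: distrib_left sum.distrib mult_ac)
    also have "(\<Sum>m=0..n. (real a + real d * real m) * c m * ?b k m)
        = (\<Sum>m=0..Suc n. (real a + real d * real m) * c m * ?b k m)"
      by (simp add: c0)
    also have "(\<Sum>m=0..n. real d * c m * ?b k (Suc m))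
        = (\<Sum>m=0..Suc n. real d * (if m = 0 then 0 else c (m - 1)) * ?b k m)"
      by (simp only: sum.atLeast0_atMost_Suc_shift) simp
    finally show ?thesis
      by (simp only: c'_def distrib_right sum.distrib)
  qed
  moreover have "\<forall>m>Suc n. c' m = 0"
    by (auto simp: c'_def c0)
  ultimately show ?case
    unfolding is_S2_row_iff by blast
qed

lemma is_S2_row_unique:
  assumes "is_S2_row d a n c" "is_S2_row d a n c'"
  shows "c = c'"
proof
  fix m
  show "c m = c' m"
  proof (induction m rule: less_induct)
    case (less k)
    show ?case
    proof (cases "k \<le> n")
      case True
      let ?b = "\<lambda>m. fact m * real (k choose m) :: real"
      have "(\<Sum>m=0..n. (c m - c' m) * ?b m) = 0"
        using assms[unfolded is_S2_row_iff] by (simp add: left_diff_distrib sum_subtractf)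
      also have "(\<Sum>m=0..n. (c m - c' m) * ?b m) = (\<Sum>m\<in>{k}. (c m - c' m) * ?b m)"
        using True less by (intro sum.mono_neutral_right)
          (auto simp: binomial_eq_0_iff not_less_iff_gr_or_eq)
      finally show ?thesis by simp
    qed (use assms in \<open>simp add: is_S2_row_def\<close>)
  qed
qed

lemma is_S2_row_S2: "is_S2_row d a n (S2 d a n)"
  proof -
  have "\<exists>!c. is_S2_row d a n c"
    using is_S2_row_exists is_S2_row_unique by blast
  then show ?thesis
    unfolding S2_def by (rule theI')
qed

end

theory Submission
  imports Defs
begin

text \<open>
  Evaluating the normal-ordered form on the geometric series expands \<open>(a + d j) ^ n\<close> in the
  binomial basis. Summing over \<open>j \<le> m\<close> raises both binomial arguments by one (hockey-stick
  identity), and the column series of Pascal's triangle are rational with denominator a power of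
  \<open>1 - x\<close>.
\<close>

text \<open>Multiplying by \<open>1 - fps_X\<close> takes differences of consecutive coefficients,
  so this is Pascal's rule.\<close>

lemma one_minus_X_mult_choose_Suc:
  "(1 - fps_X) * Abs_fps (\<lambda>m. of_nat (Suc m choose Suc k)) = (Abs_fps (\<lambda>m. of_nat (m choose k)) :: 'a::comm_ring_1 fps)"
proof (rule fps_ext)
  fix m
  show "((1 - fps_X) * Abs_fps (\<lambda>m. of_nat (Suc m choose Suc k))) $ m
      = Abs_fps (\<lambda>m. of_nat (m choose k) :: 'a) $ m"
    by (cases m) (cases k, simp_all add: left_diff_distrib)
qed

lemma one_minus_X_power_mult_choose:
  "(1 - fps_X) ^ Suc k * Abs_fps (\<lambda>m. of_nat (m choose k)) = (fps_X ^ k :: 'a::comm_ring_1 fps)"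
proof (induction k)
  case 0
  show ?case
    by (rule fps_ext) (simp add: left_diff_distrib)
next
  case (Suc k)
  \<comment> \<open>The constant coefficient \<open>0 choose Suc k\<close> vanishes, so a factor
    \<open>fps_X\<close> splits off.\<close>
  have shift: "Abs_fps (\<lambda>m. of_nat (m choose Suc k) :: 'a)
      = fps_X * Abs_fps (\<lambda>m. of_nat (Suc m choose Suc k))"
    by (rule fps_ext) (simp split: nat.split del: binomial_Suc_Suc)
  have "(1 - fps_X) ^ Suc (Suc k) * Abs_fps (\<lambda>m. of_nat (m choose Suc k) :: 'a)
      = fps_X * ((1 - fps_X) ^ Suc k
          * ((1 - fps_X) * Abs_fps (\<lambda>m. of_nat (Suc m choose Suc k))))"
    unfolding shift by (simp only: power_Suc mult_ac)
  also have "\<dots> = fps_X ^ Suc k"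
    unfolding one_minus_X_mult_choose_Suc Suc.IH by (rule power_Suc[symmetric])
  finally show ?case .
qed

text \<open>Of the \<open>k + 2\<close> factors, one turns \<open>?C\<close> into the column series
  of \<open>k\<close>, and the other \<open>k + 1\<close> reduce that to
  \<open>fps_X ^ k\<close>.\<close>

lemma X_power_div_one_minus_X_power:
  "fps_X ^ k / (1 - fps_X) ^ (k + 2) = (Abs_fps (\<lambda>m. of_nat (Suc m choose Suc k)) :: 'a::field fps)"
proof -
  let ?C = "Abs_fps (\<lambda>m. of_nat (Suc m choose Suc k)) :: 'a fps"
  have "(1 - fps_X :: 'a fps) $ 0 \<noteq> 0"
    by simp
  then have "(1 - fps_X :: 'a fps) \<noteq> 0"
    by (metis fps_zero_nth)
  moreover have "fps_X ^ k = (1 - fps_X) ^ (k + 2) * ?C"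
  proof -
    have "(1 - fps_X) ^ (k + 2) * ?C = (1 - fps_X) ^ Suc k * ((1 - fps_X) * ?C)"
      by (simp only: add_2_eq_Suc' power_Suc mult_ac)
    then show ?thesis
      by (simp only: one_minus_X_mult_choose_Suc one_minus_X_power_mult_choose)
  qed
  ultimately show ?thesis
    by simp
qed

theorem mainTheorem2:
  fixes d a n :: nat
  assumes "d \<ge> 1"
  shows "Abs_fps (\<lambda>m. \<Sum>j=0..m. (real a + real d * real j) ^ n)
       = (\<Sum>k=0..n. fps_const (S2 d a n k * fact k) * (fps_X ^ k / (1 - fps_X) ^ (k + 2)))"
proof (rule fps_ext)
  fix m
  have pow: "(real a + real d * real j) ^ n
      = (\<Sum>k=0..n. S2 d a n k * (fact k * real (j choose k)))" for j
    using is_S2_row_S2 by (simp add: is_S2_row_iff)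
  have "(\<Sum>j=0..m. (real a + real d * real j) ^ n)
      = (\<Sum>k=0..n. \<Sum>j=0..m. S2 d a n k * (fact k * real (j choose k)))"
    unfolding pow by (rule sum.swap)
  \<comment> \<open>The inner sum is moved inside \<open>real\<close> so that the hockey-stick
    identity applies over the naturals.\<close>
  also have "\<dots> = (\<Sum>k=0..n. S2 d a n k * fact k * real (\<Sum>j=0..m. j choose k))"
    by (simp only: of_nat_sum sum_distrib_left mult.assoc)
  also have "\<dots> = (\<Sum>k=0..n. S2 d a n k * fact k * real (Suc m choose Suc k))"
    by (simp only: atLeast0AtMost sum_choose_upper)
  finally show "Abs_fps (\<lambda>m. \<Sum>j=0..m. (real a + real d * real j) ^ n) $ m
      = (\<Sum>k=0..n. fps_const (S2 d a n k * fact k) * (fps_X ^ k / (1 - fps_X) ^ (k + 2))) $ m"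
    unfolding X_power_div_one_minus_X_power
    by (simp add: fps_sum_nth del: binomial_Suc_Suc)
qed

end
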